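(* Let $\mathcal{R}$ be a partial applicative structure. The PR-structure $\Sigma[\mathcal{R}]$ is preorderal if and only if there exists $\mathbf{i}\in\mathcal{R}$ such that $\mathbf{i}\cdot a=a$ for every $a\in\mathcal{R}$, and for every $r,s\in\mathcal{R}$ there exists $s\Box r\in\mathcal{R}$ such that for every $a\in\mathcal{R}$, if $s\cdot(r\cdot a)\downarrow$, then $(s\Box r)\cdot a=s\cdot(r\cdot a)$.
   Context: A partial applicative structure is a non-empty set $\mathcal{R}$ together with a partial binary function $\cdot:\mathcal{R}\times\mathcal{R}\rightharpoonup\mathcal{R}$; $t\downarrow$ means that the term $t$ (including all its subterms) is defined, and an equation asserts that both sides are defined and equal. A PR-structure is a triple $\Sigma=(\mathsf{P}_\Sigma,\mathsf{R}_\Sigma,\rho^\Sigma)$ where $\mathsf{P}_\Sigma$ and $\mathsf{R}_\Sigma$ are non-empty sets and $\rho^\Sigma:\mathsf{P}_\Sigma\times\mathsf{P}_\Sigma\to\mathcal{P}(\mathsf{R}_\Sigma)$ is a function. For a set $I$ and functions $\varphi,\psi:I\to\mathsf{P}_\Sigma$, write $\varphi\vdash^\Sigma_I\psi$ iff $\bigcap_{i\in I}\rho^\Sigma(\varphi(i),\psi(i))\neq\emptyset$, i.e. iff there is $r\in\mathsf{R}_\Sigma$ with $r\in\rho^\Sigma(\varphi(i),\psi(i))$ for every $i\in I$. $\Sigma$ is preorderal if for every set $I$ the relation $\vdash^\Sigma_I$ on $\mathsf{P}_\Sigma^I$ is a preorder. The PR-structure associated to $\mathcal{R}$ is $\Sigma[\mathcal{R}]:=(\mathcal{P}(\mathcal{R}),\mathcal{R},\Rightarrow)$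 where, for $A,B\subseteq\mathcal{R}$, $A\Rightarrow B:=\{r\in\mathcal{R}\mid \text{for every } a\in A,\ r\cdot a\downarrow \text{ and } r\cdot a\in B\}$. *)

theory Defs
  imports Main "HOL-Library.FuncSet"
begin

text \<open>
  The partial operation is represented by \<^term>\<open>app :: 'a \<Rightarrow> 'a \<Rightarrow> 'a option\<close>, where the value
  \<^term>\<open>None\<close> means "undefined"; only its values on the carrier matter. The term
  \<open>s \<cdot> (r \<cdot> a)\<close> is \<^term>\<open>Option.bind (app r a) (app s)\<close>, which differs from \<^term>\<open>None\<close> iff the
  term and its subterm \<open>r \<cdot> a\<close> are both defined.
\<close>

locale partial_applicative_structure =
  fixes R :: "'a set"
    and app :: "'a \<Rightarrow> 'a \<Rightarrow> 'a option"
  assumes nonempty: "R \<noteq> {}"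
    and app_closed: "a \<in> R \<Longrightarrow> b \<in> R \<Longrightarrow> app a b = Some c \<Longrightarrow> c \<in> R"

record ('p, 'r) pr_struct =
  props :: "'p set"
  realizer_set :: "'r set"
  rho :: "'p \<Rightarrow> 'p \<Rightarrow> 'r set"

definition is_pr_structure :: "('p, 'r) pr_struct \<Rightarrow> bool" where
  "is_pr_structure S \<longleftrightarrow> props S \<noteq> {} \<and> realizer_set S \<noteq> {} \<and>
     (\<forall>p \<in> props S. \<forall>q \<in> props S. rho S p q \<subseteq> realizer_set S)"

text \<open>
  The intersection over \<open>I\<close> is taken inside \<open>realizer_set S\<close>, so that it is the
  whole of that set when \<open>I\<close> is empty.
\<close>

definition entails :: "('p, 'r) pr_struct \<Rightarrow> 'i set \<Rightarrow> ('i \<Rightarrow> 'p) rel" where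
  "entails S I = {(\<phi>, \<psi>). \<phi> \<in> I \<rightarrow>\<^sub>E props S \<and> \<psi> \<in> I \<rightarrow>\<^sub>E props S \<and>
     (\<exists>r \<in> realizer_set S. \<forall>i \<in> I. r \<in> rho S (\<phi> i) (\<psi> i))}"

text \<open>
  A definition cannot quantify over all types of indices. Here the index sets \<open>I\<close> range over
  the sets of triples of propositions. This is no restriction: lemma \<open>preorderalD\<close>
  below shows, for every PR-structure, that the condition then holds for index sets of
  every type.
\<close>

definition preorderal :: "('p, 'r) pr_struct \<Rightarrow> bool" where
  "preorderal S \<longleftrightarrow>
     (\<forall>I :: ('p \<times> 'p \<times> 'p) set. preorder_on (I \<rightarrow>\<^sub>E props S) (entails S I))"

lemma preorderalD:
  fixes S :: "('p, 'r) pr_struct" and I :: "'i set"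
  assumes "preorderal S"
  shows "preorder_on (I \<rightarrow>\<^sub>E props S) (entails S I)"
proof -
  have transfer: "\<exists>J :: ('p \<times> 'p \<times> 'p) set. \<exists>f g h. f \<in> J \<rightarrow>\<^sub>E props S \<and> g \<in> J \<rightarrow>\<^sub>E props S \<and>
      h \<in> J \<rightarrow>\<^sub>E props S \<and>
      ((\<phi>, \<psi>) \<in> entails S I \<longleftrightarrow> (f, g) \<in> entails S J) \<and>
      ((\<psi>, \<chi>) \<in> entails S I \<longleftrightarrow> (g, h) \<in> entails S J) \<and>
      ((\<phi>, \<chi>) \<in> entails S I \<longleftrightarrow> (f, h) \<in> entails S J) \<and>
      ((\<phi>, \<phi>) \<in> entails S I \<longleftrightarrow> (f, f) \<in> entails S J)"
    if *: "\<phi> \<in> I \<rightarrow>\<^sub>E props S" "\<psi> \<in> I \<rightarrow>\<^sub>E props S" "\<chi> \<in> I \<rightarrow>\<^sub>E props S" for \<phi> \<psi> \<chi>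
  proof -
    define J where "J = (\<lambda>i. (\<phi> i, \<psi> i, \<chi> i)) ` I"
    define f where "f = restrict fst J"
    define g where "g = restrict (\<lambda>j. fst (snd j)) J"
    define h where "h = restrict (\<lambda>j. snd (snd j)) J"
    have mem: "f \<in> J \<rightarrow>\<^sub>E props S" "g \<in> J \<rightarrow>\<^sub>E props S" "h \<in> J \<rightarrow>\<^sub>E props S"
      using * by (auto simp: f_def g_def h_def J_def PiE_iff)
    have J: "(\<forall>j \<in> J. P (f j) (g j) (h j)) \<longleftrightarrow> (\<forall>i \<in> I. P (\<phi> i) (\<psi> i) (\<chi> i))" for P
      by (auto simp: f_def g_def h_def J_def)
    show ?thesis
      using mem * J[of "\<lambda>x y z. _ \<in> rho S x y"] J[of "\<lambda>x y z. _ \<in> rho S y z"]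
        J[of "\<lambda>x y z. _ \<in> rho S x z"] J[of "\<lambda>x y z. _ \<in> rho S x x"]
      by (intro exI[of _ J] exI[of _ f] exI[of _ g] exI[of _ h]) (simp add: entails_def)
  qed
  have pre: "preorder_on (J \<rightarrow>\<^sub>E props S) (entails S J)" for J :: "('p \<times> 'p \<times> 'p) set"
    using assms by (simp add: preorderal_def)
  have sub: "entails S I \<subseteq> (I \<rightarrow>\<^sub>E props S) \<times> (I \<rightarrow>\<^sub>E props S)"
    by (auto simp: entails_def)
  have "(\<phi>, \<phi>) \<in> entails S I" if "\<phi> \<in> I \<rightarrow>\<^sub>E props S" for \<phi>
    using transfer[OF that that that] pre unfolding preorder_on_def refl_on_def by blast
  moreover have "trans (entails S I)"
  proof (rule transI)
    fix \<phi> \<psi> \<chi>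
    assume a: "(\<phi>, \<psi>) \<in> entails S I" "(\<psi>, \<chi>) \<in> entails S I"
    then have "\<phi> \<in> I \<rightarrow>\<^sub>E props S" "\<psi> \<in> I \<rightarrow>\<^sub>E props S" "\<chi> \<in> I \<rightarrow>\<^sub>E props S"
      using sub by auto
    from transfer[OF this] a pre show "(\<phi>, \<chi>) \<in> entails S I"
      unfolding preorder_on_def trans_def by blast
  qed
  ultimately show ?thesis
    using sub unfolding preorder_on_def refl_on_def by blast
qed

definition arrow :: "'a set \<Rightarrow> ('a \<Rightarrow> 'a \<Rightarrow> 'a option) \<Rightarrow> 'a set \<Rightarrow> 'a set \<Rightarrow> 'a set" where
  "arrow R app A B = {r \<in> R. \<forall>a \<in> A. \<exists>b \<in> B. app r a = Some b}"

definition assoc_pr :: "'a set \<Rightarrow> ('a \<Rightarrow> 'a \<Rightarrow> 'a option) \<Rightarrow> ('a set, 'a) pr_struct" where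
  "assoc_pr R app = \<lparr>props = Pow R, realizer_set = R, rho = arrow R app\<rparr>"

lemma is_pr_structure_assoc_pr:
  assumes "partial_applicative_structure R app"
  shows "is_pr_structure (assoc_pr R app)"
  using partial_applicative_structure.nonempty[OF assms]
  by (auto simp: is_pr_structure_def assoc_pr_def arrow_def)

end

theory Submission
  imports Defs
begin

text \<open>
  For the forward direction, reflexivity and transitivity are applied to families of singletons:
  a realizer of \<open>{a} \<Rightarrow> {b}\<close> is an element sending \<open>a\<close> to \<open>b\<close>, so a
  realizer that is uniform in \<open>a\<close> is exactly an identity, respectively a composite. Conversely,
  an identity and composites realize reflexivity and transitivity for all families at once.
\<close>

lemma entails_assoc_pr_iff:
  "(\<phi>, \<psi>) \<in> entails (assoc_pr R app) I \<longleftrightarrow>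
    \<phi> \<in> I \<rightarrow>\<^sub>E Pow R \<and> \<psi> \<in> I \<rightarrow>\<^sub>E Pow R \<and>
    (\<exists>r \<in> R. \<forall>i \<in> I. \<forall>a \<in> \<phi> i. \<exists>b \<in> \<psi> i. app r a = Some b)"
  by (auto simp: entails_def assoc_pr_def arrow_def)

text \<open>The composite chosen by \<open>comp\<close> depends on the two realizers alone and not
  on the index, so a single element works over all of \<open>I\<close>.\<close>

lemma preorder_on_entails_assoc_pr:
  fixes R :: "'a set" and I :: "'i set"
  assumes id: "\<exists>i \<in> R. \<forall>a \<in> R. app i a = Some a"
    and comp: "\<forall>r \<in> R. \<forall>s \<in> R. \<exists>t \<in> R. \<forall>a \<in> R.
      Option.bind (app r a) (app s) \<noteq> None \<longrightarrow> app t a = Option.bind (app r a) (app s)"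
  shows "preorder_on (I \<rightarrow>\<^sub>E Pow R) (entails (assoc_pr R app) I)"
proof -
  let ?S = "assoc_pr R app"
  \<comment> \<open>Both \<open>id\<close> and \<open>comp\<close> speak only of arguments in
    \<open>R\<close>; this makes them applicable to the elements of each
    \<open>\<phi> i\<close>.\<close>
  have in_R: "a \<in> R" if "\<phi> \<in> I \<rightarrow>\<^sub>E Pow R" "i \<in> I" "a \<in> \<phi> i" for \<phi> i a
    using PiE_mem[OF that(1,2)] that(3) by blast
  have "refl_on (I \<rightarrow>\<^sub>E Pow R) (entails ?S I)"
  proof (rule refl_onI)
    fix \<phi> assume "\<phi> \<in> I \<rightarrow>\<^sub>E Pow R"
    with id in_R[of \<phi>] show "(\<phi>, \<phi>) \<in> entails ?S I"
      unfolding entails_assoc_pr_iff by blast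
  qed
  moreover have "trans (entails ?S I)"
  proof (rule transI)
    fix \<phi> \<psi> \<chi> assume \<phi>\<psi>: "(\<phi>, \<psi>) \<in> entails ?S I" and \<psi>\<chi>: "(\<psi>, \<chi>) \<in> entails ?S I"
    have fam: "\<phi> \<in> I \<rightarrow>\<^sub>E Pow R" "\<chi> \<in> I \<rightarrow>\<^sub>E Pow R"
      using \<phi>\<psi> \<psi>\<chi> unfolding entails_assoc_pr_iff by blast+
    obtain r where r: "r \<in> R" "\<And>i a. i \<in> I \<Longrightarrow> a \<in> \<phi> i \<Longrightarrow> \<exists>b \<in> \<psi> i. app r a = Some b"
      using \<phi>\<psi> unfolding entails_assoc_pr_iff by blast
    obtain s where s: "s \<in> R" "\<And>i b. i \<in> I \<Longrightarrow> b \<in> \<psi> i \<Longrightarrow> \<exists>c \<in> \<chi> i. app s b = Some c"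
      using \<psi>\<chi> unfolding entails_assoc_pr_iff by blast
    obtain t where t: "t \<in> R" "\<forall>a \<in> R. Option.bind (app r a) (app s) \<noteq> None \<longrightarrow>
        app t a = Option.bind (app r a) (app s)"
      using comp r(1) s(1) by blast
    have "\<exists>c \<in> \<chi> i. app t a = Some c" if ia: "i \<in> I" "a \<in> \<phi> i" for i a
    proof -
      obtain b where b: "b \<in> \<psi> i" "app r a = Some b" using r(2)[OF ia] ..
      obtain c where c: "c \<in> \<chi> i" "app s b = Some c" using s(2)[OF ia(1) b(1)] ..
      \<comment> \<open>Since \<open>app r a\<close> is \<open>Some b\<close> and
        \<open>app s b\<close> is \<open>Some c\<close>, the definedness premise on \<open>t\<close>
        holds at \<open>a\<close>, and \<open>t\<close> sends \<open>a\<close> to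
        \<open>c\<close>.\<close>
      show ?thesis
        using bspec[OF t(2) in_R[OF fam(1) ia]] b(2) c by simp
    qed
    with t(1) fam show "(\<phi>, \<chi>) \<in> entails ?S I"
      unfolding entails_assoc_pr_iff by blast
  qed
  moreover have "entails ?S I \<subseteq> (I \<rightarrow>\<^sub>E Pow R) \<times> (I \<rightarrow>\<^sub>E Pow R)"
    by (auto simp: entails_def assoc_pr_def)
  ultimately show ?thesis
    by (simp add: preorder_on_def)
qed

theorem proposition3p2:
  fixes R :: "'a set" and app :: "'a \<Rightarrow> 'a \<Rightarrow> 'a option"
  assumes "partial_applicative_structure R app"
  shows "preorderal (assoc_pr R app) \<longleftrightarrow>
    (\<exists>i \<in> R. \<forall>a \<in> R. app i a = Some a) \<and>
    (\<forall>r \<in> R. \<forall>s \<in> R. \<exists>t \<in> R. \<forall>a \<in> R.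
       Option.bind (app r a) (app s) \<noteq> None \<longrightarrow> app t a = Option.bind (app r a) (app s))"
    (is "?P \<longleftrightarrow> ?id \<and> ?comp")
proof -
  have app_closed: "c \<in> R" if "a \<in> R" "b \<in> R" "app a b = Some c" for a b c
    using partial_applicative_structure.app_closed[OF assms that] .
  let ?S = "assoc_pr R app"
  show ?thesis
  proof
    assume ?P
    \<comment> \<open>The definition of \<open>preorderal\<close> gives this for sets of triples of
      sets; \<open>preorderalD\<close> moves it to index sets consisting of elements, as used
      below.\<close>
    then have refl: "refl_on (I \<rightarrow>\<^sub>E Pow R) (entails ?S I)" and trans: "trans (entails ?S I)"
      for I :: "'a set"
      using preorderalD[of ?S I] by (auto simp: preorder_on_def assoc_pr_def)
    have singleton_iff: "((\<lambda>a\<in>I. {f a}), (\<lambda>a\<in>I. {g a})) \<in> entails ?S I \<longleftrightarrow>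
        (\<exists>r \<in> R. \<forall>a \<in> I. app r (f a) = Some (g a))"
      if "f \<in> I \<rightarrow> R" "g \<in> I \<rightarrow> R" for f g and I :: "'a set"
      using that by (auto simp: entails_assoc_pr_iff)
    \<comment> \<open>Here \<open>R\<close> indexes its own singletons, so that one realizer of
      reflexivity has to fix every element.\<close>
    have ?id
      using refl_onD[OF refl[of R], of "\<lambda>a\<in>R. {a}"] singleton_iff[of "\<lambda>a. a" R "\<lambda>a. a"]
      by auto
    moreover have ?comp
    proof (intro ballI)
      fix r s assume rs: "r \<in> R" "s \<in> R"
      \<comment> \<open>Indexing by the domain of the composite ensures that \<open>r\<close> and
        \<open>s\<close> realize the two entailments below. Outside \<open>I\<close> nothing is
        asked of \<open>t\<close>, which matches the conditional form of the claim.\<close>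
      define I where "I = {a \<in> R. Option.bind (app r a) (app s) \<noteq> None}"
      \<comment> \<open>Off \<open>I\<close> the values of \<open>the\<close> may be arbitrary; the
        families below are restricted to \<open>I\<close>.\<close>
      define f where "f = (\<lambda>a. the (app r a))"
      define g where "g = (\<lambda>a. the (app s (f a)))"
      have eq: "app r a = Some (f a)" "app s (f a) = Some (g a)" if "a \<in> I" for a
        using that by (auto simp: I_def f_def g_def split: bind_splits)
      have mem: "(\<lambda>a. a) \<in> I \<rightarrow> R" "f \<in> I \<rightarrow> R" "g \<in> I \<rightarrow> R"
      proof -
        show "(\<lambda>a. a) \<in> I \<rightarrow> R" by (auto simp: I_def)
        \<comment> \<open>Closure of \<open>R\<close> under application makes the singletons
          \<open>{f a}\<close>, and likewise \<open>{g a}\<close>, subsets of \<open>R\<close>,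
          hence legitimate propositions.\<close>
        show f: "f \<in> I \<rightarrow> R" using app_closed[OF rs(1) _ eq(1)] by (simp add: I_def)
        show "g \<in> I \<rightarrow> R" using app_closed[OF rs(2) funcset_mem[OF f] eq(2)] by simp
      qed
      have "((\<lambda>a\<in>I. {a}), (\<lambda>a\<in>I. {f a})) \<in> entails ?S I"
        using singleton_iff[OF mem(1,2)] rs(1) eq(1) by blast
      moreover have "((\<lambda>a\<in>I. {f a}), (\<lambda>a\<in>I. {g a})) \<in> entails ?S I"
        using singleton_iff[OF mem(2,3)] rs(2) eq(2) by blast
      ultimately have "((\<lambda>a\<in>I. {a}), (\<lambda>a\<in>I. {g a})) \<in> entails ?S I"
        by (rule transD[OF trans])
      then obtain t where t: "t \<in> R" "\<forall>a \<in> I. app t a = Some (g a)"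
        using singleton_iff[OF mem(1,3)] by blast
      \<comment> \<open>Definedness of the composite at \<open>a\<close> is membership in
        \<open>I\<close>, where both sides equal \<open>Some (g a)\<close>.\<close>
      have "app t a = Option.bind (app r a) (app s)"
        if "a \<in> R" "Option.bind (app r a) (app s) \<noteq> None" for a
        using that t(2) eq[of a] by (simp add: I_def)
      with t(1) show "\<exists>t \<in> R. \<forall>a \<in> R. Option.bind (app r a) (app s) \<noteq> None \<longrightarrow>
          app t a = Option.bind (app r a) (app s)"
        by blast
    qed
    ultimately show "?id \<and> ?comp" ..
  next
    assume "?id \<and> ?comp"
    \<comment> \<open>The index type is the one fixed in \<open>preorderal\<close>: triples of
      propositions, which here are sets of elements.\<close>
    from preorder_on_entails_assoc_pr[OF conjunct1[OF this] conjunct2[OF this],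
        where ?'i = "'a set \<times> 'a set \<times> 'a set"]
    show ?P
      by (simp add: preorderal_def assoc_pr_def)
  qed
qed

end
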